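(* Let $d,N\ge 1$, let $\{|x\rangle\}_{x=0}^{d-1}$ be an orthonormal basis of $\mathbb{C}^d$, $\Pi_x=|x\rangle\langle x|$, and let $\{K_m\}$ be a finite family of operators on $\mathbb{C}^d$ with $\sum_m K_m^\dagger K_m=\mathbb{1}$ and $\gamma_{xm}$ complex coefficients such that $\rho\,\Pi_x=\sum_m\gamma_{xm}K_m\rho K_m^\dagger$ for all $x$ and all density matrices $\rho$. Let $\rho_{t_1}$ be a density matrix and ${\cal N}_{t_i\to t_{i+1}}$ ($1\le i\le N-1$) quantum channels on $\mathbb{C}^d$. Then for all $x_1,\dots,x_N\in\{0,\dots,d-1\}$ the $N$-time quasi-probability distribution satisfies $$p(x_1,\dots,x_N)=\sum_{m_1,\dots,m_N}p^{\cal K}(m_1,\dots,m_N)\prod_{i=1}^N\gamma_{x_im_i}=\mathbb{E}\Big[\prod_{i=1}^N\gamma_{x_im_i}\Big],$$ where $\mathbb{E}$ denotes expectation over $(m_1,\dots,m_N)$ distributed according to the probability distribution $p^{\cal K}$.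
   Context: A quantum channel is a completely positive trace-preserving linear map on operators on $\mathbb{C}^d$. Define the linear maps ${\cal M}_x(\rho)=\rho\,\Pi_x$ and ${\cal K}_m(\rho)=K_m\rho K_m^\dagger$. The $N$-time quasi-probability distribution is $$p(x_1,\dots,x_N)=\mathrm{Tr}\big[({\cal M}_{x_N}\circ{\cal N}_{t_{N-1}\to t_N}\circ\cdots\circ{\cal M}_{x_2}\circ{\cal N}_{t_1\to t_2}\circ{\cal M}_{x_1})(\rho_{t_1})\big]\in\mathbb{C},$$ and the distribution of sequential measurement outcomes (observed trajectories) is $$p^{\cal K}(m_1,\dots,m_N)=\mathrm{Tr}\big[({\cal K}_{m_N}\circ{\cal N}_{t_{N-1}\to t_N}\circ\cdots\circ{\cal N}_{t_1\to t_2}\circ{\cal K}_{m_1})(\rho_{t_1})\big].$$ *)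

theory Defs
  imports
    "HOL-Probability.Probability"
    "HOL-Library.Complex_Order"
begin

type_synonym 'd cop = "complex ^ 'd ^ 'd"

definition cscale :: "complex \<Rightarrow> 'd::finite cop \<Rightarrow> 'd cop"  (infixr "*\<^sub>C" 75) where
  "c *\<^sub>C A = (\<chi> i j. c * A $ i $ j)"

lemma vector_space_cscale: "vector_space (cscale :: complex \<Rightarrow> 'd::finite cop \<Rightarrow> 'd cop)"
  by unfold_locales (simp_all add: cscale_def vec_eq_iff algebra_simps)

definition dagger :: "'d::finite cop \<Rightarrow> 'd cop" where
  "dagger A = (\<chi> i j. cnj (A $ j $ i))"

text \<open>Antilinear in the first argument; the library's inner product on \<^typ>\<open>complex ^ 'd\<close> is
  only its real part.\<close>

definition cinner :: "complex ^ 'd::finite \<Rightarrow> complex ^ 'd \<Rightarrow> complex" where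
  "cinner v w = (\<Sum>i\<in>UNIV. cnj (v $ i) * w $ i)"

definition orthonormal_basis :: "(nat \<Rightarrow> complex ^ 'd::finite) \<Rightarrow> bool" where
  "orthonormal_basis ket \<longleftrightarrow>
     (\<forall>x<CARD('d). \<forall>y<CARD('d). cinner (ket x) (ket y) = (if x = y then 1 else 0)) \<and>
     vec.span (ket ` {..<CARD('d)}) = UNIV"

definition ketbra :: "complex ^ 'd::finite \<Rightarrow> 'd cop" where
  "ketbra v = (\<chi> i j. v $ i * cnj (v $ j))"

text \<open>The order on \<^typ>\<open>complex\<close> is that of \<^theory>\<open>HOL-Library.Complex_Order\<close>, so that
  \<^prop>\<open>0 \<le> z\<close> says that \<^term>\<open>z\<close> is real and nonnegative. Over the complex numbers, this
  condition on the quadratic form implies that the matrix is Hermitian.\<close>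

definition psd :: "'d::finite cop \<Rightarrow> bool" where
  "psd A \<longleftrightarrow> (\<forall>v. 0 \<le> cinner v (A *v v))"

definition density_matrix :: "'d::finite cop \<Rightarrow> bool" where
  "density_matrix \<rho> \<longleftrightarrow> psd \<rho> \<and> trace \<rho> = 1"

text \<open>An operator on the tensor product of \<open>\<complex>^k\<close> and \<open>\<complex>^d\<close> is a \<open>k\<close> by \<open>k\<close> block matrix
  \<^term>\<open>X\<close> of operators on \<open>\<complex>^d\<close>, vectors of the tensor product are \<open>k\<close>-tuples of
  vectors of \<open>\<complex>^d\<close>, and the map \<open>id_k\<close> tensor \<open>\<Phi>\<close> acts blockwise.
  Only the indices below \<open>k\<close> matter.\<close>

definition block_psd :: "nat \<Rightarrow> (nat \<Rightarrow> nat \<Rightarrow> 'd::finite cop) \<Rightarrow> bool" where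
  "block_psd k X \<longleftrightarrow>
     (\<forall>v :: nat \<Rightarrow> complex ^ 'd. 0 \<le> (\<Sum>i<k. \<Sum>j<k. cinner (v i) (X i j *v v j)))"

definition completely_positive :: "('d::finite cop \<Rightarrow> 'd cop) \<Rightarrow> bool" where
  "completely_positive \<Phi> \<longleftrightarrow>
     (\<forall>k X. block_psd k X \<longrightarrow> block_psd k (\<lambda>i j. \<Phi> (X i j)))"

definition quantum_channel :: "('d::finite cop \<Rightarrow> 'd cop) \<Rightarrow> bool" where
  "quantum_channel \<Phi> \<longleftrightarrow>
     Vector_Spaces.linear cscale cscale \<Phi> \<and> completely_positive \<Phi> \<and>
     (\<forall>A. trace (\<Phi> A) = trace A)"

definition proj_map :: "(nat \<Rightarrow> complex ^ 'd::finite) \<Rightarrow> nat \<Rightarrow> 'd cop \<Rightarrow> 'd cop" where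
  "proj_map ket x \<rho> = \<rho> ** ketbra (ket x)"

definition meas_map :: "('m \<Rightarrow> 'd::finite cop) \<Rightarrow> 'm \<Rightarrow> 'd cop \<Rightarrow> 'd cop" where
  "meas_map K m \<rho> = K m ** \<rho> ** dagger (K m)"

text \<open>For \<open>N \<ge> 1\<close>, \<open>interleave A C N\<close> is the composition of
  \<open>A N\<close>, \<open>C (N - 1)\<close>, \<open>A (N - 1)\<close>, ..., \<open>C 1\<close>, \<open>A 1\<close>, the last being applied first.\<close>

fun interleave :: "(nat \<Rightarrow> 'a \<Rightarrow> 'a) \<Rightarrow> (nat \<Rightarrow> 'a \<Rightarrow> 'a) \<Rightarrow> nat \<Rightarrow> 'a \<Rightarrow> 'a" where
  "interleave A C 0 = id"
| "interleave A C (Suc 0) = A 1"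
| "interleave A C (Suc (Suc n)) = A (Suc (Suc n)) \<circ> C (Suc n) \<circ> interleave A C (Suc n)"

text \<open>In the following, \<open>Ch i\<close> is the channel from time \<open>t_i\<close> to time \<open>t_(i+1)\<close>, and the
  results \<open>x i\<close> and \<open>m i\<close> are indexed by \<open>i \<in> {1..N}\<close>.\<close>

definition quasi_prob ::
  "(nat \<Rightarrow> complex ^ 'd::finite) \<Rightarrow> (nat \<Rightarrow> 'd cop \<Rightarrow> 'd cop) \<Rightarrow> 'd cop \<Rightarrow> nat \<Rightarrow> (nat \<Rightarrow> nat) \<Rightarrow> complex"
where
  "quasi_prob ket Ch \<rho> N x = trace (interleave (\<lambda>i. proj_map ket (x i)) Ch N \<rho>)"

definition traj_prob ::
  "('m \<Rightarrow> 'd::finite cop) \<Rightarrow> (nat \<Rightarrow> 'd cop \<Rightarrow> 'd cop) \<Rightarrow> 'd cop \<Rightarrow> nat \<Rightarrow> (nat \<Rightarrow> 'm) \<Rightarrow> complex"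
where
  "traj_prob K Ch \<rho> N m = trace (interleave (\<lambda>i. meas_map K (m i)) Ch N \<rho>)"

definition trajectories :: "'m set \<Rightarrow> nat \<Rightarrow> (nat \<Rightarrow> 'm) set" where
  "trajectories M N = PiE {1..N} (\<lambda>_. M)"

text \<open>\<^const>\<open>embed_pmf\<close> is only meaningful for nonnegative weights of total mass 1, so a
  statement about \<open>traj_pmf\<close> has to be accompanied by the claim that its mass function is
  \<^const>\<open>traj_prob\<close>.\<close>

definition traj_pmf ::
  "'m set \<Rightarrow> ('m \<Rightarrow> 'd::finite cop) \<Rightarrow> (nat \<Rightarrow> 'd cop \<Rightarrow> 'd cop) \<Rightarrow> 'd cop \<Rightarrow> nat \<Rightarrow> (nat \<Rightarrow> 'm) pmf"
where
  "traj_pmf M K Ch \<rho> N =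
     embed_pmf (\<lambda>m. if m \<in> trajectories M N then Re (traj_prob K Ch \<rho> N m) else 0)"

end

(* Density matrices span all operators, by polarization, so the reconstruction identity
   rho Pi_x = sum_m gamma_xm K_m rho K_m^* extends to all operators. Substituting it for every
   projection and expanding by linearity of the channels gives the formula. That p^K is a
   probability distribution follows since measurements and channels preserve positivity, and
   the sum over the outcomes of a measurement preserves the trace. *)

theory Submission
  imports Defs
begin

section \<open>Operators as a complex vector space and linearity of the basic maps\<close>

interpretation cop: vector_space "cscale :: complex \<Rightarrow> 'd::finite cop \<Rightarrow> 'd cop"
  by (rule vector_space_cscale)

interpretation cop: vector_space_pair
  "cscale :: complex \<Rightarrow> 'd::finite cop \<Rightarrow> 'd cop"
  "cscale :: complex \<Rightarrow> 'd::finite cop \<Rightarrow> 'd cop"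
  by unfold_locales

lemma trace_cscale: "trace (c *\<^sub>C A) = c * trace A"
  by (simp add: trace_def cscale_def sum_distrib_left)

lemma trace_sum: "trace (\<Sum>i\<in>I. A i) = (\<Sum>i\<in>I. trace (A i :: 'd::finite cop))"
  by (induction I rule: infinite_finite_induct) (simp_all add: trace_add trace_def[of 0])

lemma matrix_sum_rdistrib:
  fixes B :: "'d::finite cop"
  shows "(\<Sum>i\<in>I. A i) ** B = (\<Sum>i\<in>I. A i ** B)"
  by (simp add: matrix_matrix_mult_def vec_eq_iff sum_distrib_right)
     (intro allI sum.swap)

text \<open>The two-sided form serves both kinds of maps: \<open>B = dagger A\<close> gives the
  measurement maps, and \<open>A = mat 1\<close> gives right multiplication by a projection.\<close>

lemma linear_matrix_mult:
  fixes A B :: "'d::finite cop"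
  shows "Vector_Spaces.linear cscale cscale (\<lambda>\<rho>. A ** \<rho> ** B)"
proof -
  have "(X + Y) ** B = X ** B + Y ** B" for X Y :: "'d cop"
    by (simp add: matrix_matrix_mult_def vec_eq_iff distrib_right sum.distrib)
  moreover have "(c *\<^sub>C X) ** B = c *\<^sub>C (X ** B)" "A ** (c *\<^sub>C X) = c *\<^sub>C (A ** X)"
    for c X
    by (simp_all add: matrix_matrix_mult_def cscale_def vec_eq_iff sum_distrib_left mult_ac)
  ultimately show ?thesis
    unfolding Vector_Spaces.linear_iff by (simp add: vector_space_cscale matrix_add_ldistrib)
qed

lemma linear_meas_map: "Vector_Spaces.linear cscale cscale (meas_map K m)"
  using linear_matrix_mult[of "K m" "dagger (K m)"] by (simp add: meas_map_def[abs_def])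

lemma linear_proj_map: "Vector_Spaces.linear cscale cscale (proj_map ket x)"
  using linear_matrix_mult[of "mat 1" "ketbra (ket x)"] by (simp add: proj_map_def[abs_def])

section \<open>Rank-one operators and the span of the density matrices\<close>

lemma mult_cnj_nonneg: "0 \<le> z * cnj z"
  by (simp add: less_eq_complex_def)

lemma cinner_ketbra: "cinner w (ketbra v *v w) = cinner w v * cnj (cinner w v)"
  by (simp add: cinner_def ketbra_def matrix_vector_mult_def sum_product
      sum_distrib_left mult_ac)
    (rule sum.swap)

lemma cinner_self_nonneg: "0 \<le> cinner v v"
  unfolding cinner_def by (intro sum_nonneg) (simp add: mult.commute mult_cnj_nonneg)

lemma cinner_self_eq_0: "cinner v v = 0 \<longleftrightarrow> v = 0"
proof -
  have "cinner v v = 0 \<longleftrightarrow> (\<forall>i\<in>UNIV. cnj (v $ i) * v $ i = 0)"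
    unfolding cinner_def
    by (rule sum_nonneg_eq_0_iff) (simp_all add: mult.commute mult_cnj_nonneg)
  then show ?thesis by (simp add: vec_eq_iff)
qed

lemma trace_ketbra: "trace (ketbra v) = cinner v v"
  by (simp add: trace_def ketbra_def cinner_def mult.commute)

text \<open>This is the pure state of the normalized vector. The quadratic form of
  \<open>ketbra v\<close> at \<open>w\<close> is the squared modulus of \<open>cinner w v\<close>,
  and its trace is the squared norm of \<open>v\<close>.\<close>

lemma density_matrix_ketbra:
  assumes "v \<noteq> 0"
  shows "density_matrix (inverse (cinner v v) *\<^sub>C ketbra v)"
proof -
  have [simp]: "cinner w (c *\<^sub>C A *v w) = c * cinner w (A *v w)"
    for w :: "complex ^ 'a" and c A
    by (simp add: cinner_def cscale_def matrix_vector_mult_def sum_distrib_left mult_ac)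
  have "0 \<le> inverse (cinner v v)"
    using cinner_self_nonneg[of v] by (auto simp: less_eq_complex_def complex_eq_iff)
  then have "0 \<le> inverse (cinner v v) * (cinner w v * cnj (cinner w v))" for w
    by (intro mult_nonneg_nonneg mult_cnj_nonneg)
  then show ?thesis
    using assms
    by (simp add: density_matrix_def psd_def trace_cscale trace_ketbra cinner_ketbra
        cinner_self_eq_0)
qed

text \<open>The alternative \<open>c = 0\<close> covers the zero vector, which cannot be normalized;
  linear maps agree there in any case.\<close>

lemma ketbra_eq_scaled_density:
  obtains c \<rho> where "ketbra v = c *\<^sub>C \<rho>" "c = 0 \<or> density_matrix \<rho>"
proof (cases "v = 0")
  case True
  then have "ketbra v = 0 *\<^sub>C 0"
    by (simp add: ketbra_def vec_eq_iff)
  then show thesis using that by blast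
next
  case False
  then have "ketbra v = cinner v v *\<^sub>C (inverse (cinner v v) *\<^sub>C ketbra v)"
    by (simp add: cinner_self_eq_0)
  then show thesis using that density_matrix_ketbra[OF False] by blast
qed

text \<open>The operator usually written |v><w|. For standard basis vectors these are the matrix
  units.\<close>

definition outer :: "complex ^ 'd::finite \<Rightarrow> complex ^ 'd \<Rightarrow> 'd cop" where
  "outer v w = (\<chi> i j. v $ i * cnj (w $ j))"

text \<open>The factor \<open>\<i>\<close> makes the two contributions of \<open>outer w v\<close>
  cancel and those of \<open>outer v w\<close> add up to twice that operator. The last term removes
  the diagonal contributions.\<close>

lemma polarization:
  "outer v w = (1/2) *\<^sub>C (ketbra (v + w) + \<i> *\<^sub>C ketbra (v + \<i> *s w)
     - (1 + \<i>) *\<^sub>C (ketbra v + ketbra w))"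
  by (simp add: outer_def ketbra_def cscale_def vec_eq_iff algebra_simps)

lemma sum_outer_axis: "A = (\<Sum>i\<in>UNIV. \<Sum>j\<in>UNIV. A $ i $ j *\<^sub>C outer (axis i 1) (axis j 1))"
proof -
  have "(A $ i $ j *\<^sub>C outer (axis i 1) (axis j 1)) $ k $ l =
      (if l = j then if k = i then A $ i $ j else 0 else 0)" for i j k l
    by (simp add: outer_def cscale_def axis_def)
  then show ?thesis
    by (simp add: vec_eq_iff)
qed

text \<open>Agreement passes from density matrices to every \<open>ketbra v\<close> by scaling, then
  to every \<open>outer v w\<close> by polarization, then to all operators by expansion in matrix
  units.\<close>

lemma linear_eq_on_density_matrices:
  assumes F: "Vector_Spaces.linear cscale cscale (F :: 'd::finite cop \<Rightarrow> 'd cop)"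
    and G: "Vector_Spaces.linear cscale cscale G"
    and eq: "\<And>\<rho>. density_matrix \<rho> \<Longrightarrow> F \<rho> = G \<rho>"
  shows "F = G"
proof
  fix A
  note [simp] = cop.linear_add[OF F] cop.linear_add[OF G] cop.linear_scale[OF F]
    cop.linear_scale[OF G] cop.linear_sum[OF F] cop.linear_sum[OF G]
    cop.linear_diff[OF F] cop.linear_diff[OF G]
  have "F (ketbra v) = G (ketbra v)" for v
    by (rule ketbra_eq_scaled_density[of v]) (auto simp: eq)
  then have "F (outer v w) = G (outer v w)" for v w
    by (simp add: polarization)
  then show "F A = G A"
    by (subst (1 2) sum_outer_axis[of A]) simp
qed

section \<open>Alternating compositions and their multilinear expansion\<close>

lemma interleave_Suc:
  "interleave A C (Suc n) = A (Suc n) \<circ> (if n = 0 then id else C n) \<circ> interleave A C n"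
  by (cases n) auto

lemma interleave_cong:
  "(\<And>i. i \<in> {1..n} \<Longrightarrow> A i = B i) \<Longrightarrow> interleave A C n = interleave B C n"
  by (induction n) (simp_all add: interleave_Suc)

text \<open>A trajectory with one more time is a shorter one together with a final outcome. The pair
  is unique because members of \<open>PiE\<close> are fixed outside their domain, which does not
  contain \<open>Suc n\<close>.\<close>

lemma sum_trajectories_Suc:
  "(\<Sum>m\<in>trajectories M (Suc n). f m) = (\<Sum>k\<in>M. \<Sum>m\<in>trajectories M n. f (m(Suc n := k)))"
proof -
  have *: "trajectories M (Suc n) = (\<lambda>(k, m). m(Suc n := k)) ` (M \<times> trajectories M n)"
    by (simp add: trajectories_def atLeastAtMostSuc_conv PiE_insert_eq)
  have "inj_on (\<lambda>(k, m). m(Suc n := k)) (M \<times> trajectories M n)"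
    unfolding trajectories_def by (rule inj_combinator) simp
  then show ?thesis
    unfolding * by (simp add: sum.reindex sum.cartesian_product case_prod_unfold)
qed

text \<open>Used twice: with the coefficients \<open>\<gamma>\<close> for the quasi-probability, and
  with all coefficients 1 for the total mass of the trajectories.\<close>

lemma interleave_expansion:
  fixes A B C :: "_ \<Rightarrow> 'd::finite cop \<Rightarrow> 'd cop"
  assumes A: "\<And>i \<sigma>. i \<in> {1..n} \<Longrightarrow> A i \<sigma> = (\<Sum>k\<in>M. g i k *\<^sub>C B k \<sigma>)"
    and B: "\<And>k. Vector_Spaces.linear cscale cscale (B k)"
    and C: "\<And>i. i \<in> {1..n - 1} \<Longrightarrow> Vector_Spaces.linear cscale cscale (C i)"
  shows "interleave A C n \<rho> =
    (\<Sum>m\<in>trajectories M n. (\<Prod>i=1..n. g i (m i)) *\<^sub>C interleave (\<lambda>i. B (m i)) C n \<rho>)"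
  using A C
proof (induction n)
  case 0
  then show ?case by (simp add: trajectories_def)
next
  case (Suc n)
  \<comment> \<open>No channel precedes the first operation, so the identity stands in for it and
    both cases share one induction step.\<close>
  define C' where "C' = (if n = 0 then id else C n)"
  have C': "Vector_Spaces.linear cscale cscale C'"
    using Suc.prems(2)[of n] by (auto simp: C'_def cop.linear_id)
  have IH: "interleave A C n \<rho> =
    (\<Sum>m\<in>trajectories M n. (\<Prod>i=1..n. g i (m i)) *\<^sub>C interleave (\<lambda>i. B (m i)) C n \<rho>)"
    using Suc.prems by (intro Suc.IH) auto
  \<comment> \<open>The first \<open>n\<close> operations do not see the outcome at time
    \<open>Suc n\<close>, so the inner composition and product are independent of
    \<open>k\<close>.\<close>
  have upd: "interleave (\<lambda>i. B ((m(Suc n := k)) i)) C n = interleave (\<lambda>i. B (m i)) C n"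
    for m k by (rule interleave_cong) simp
  have prod_upd: "(\<Prod>i=1..n. g i ((m(Suc n := k)) i)) = (\<Prod>i=1..n. g i (m i))" for m k
    by (rule prod.cong) auto
  have "interleave A C (Suc n) \<rho> = (\<Sum>k\<in>M. g (Suc n) k *\<^sub>C B k (C' (interleave A C n \<rho>)))"
    using Suc.prems(1)[of "Suc n"] by (simp add: interleave_Suc C'_def)
  also have "\<dots> = (\<Sum>m\<in>trajectories M (Suc n).
      (\<Prod>i=1..Suc n. g i (m i)) *\<^sub>C interleave (\<lambda>i. B (m i)) C (Suc n) \<rho>)"
    unfolding IH sum_trajectories_Suc interleave_Suc C'_def[symmetric] o_apply upd
    by (simp add: prod_upd[simplified] cop.linear_sum[OF C'] cop.linear_scale[OF C']
        cop.linear_sum[OF B] cop.linear_scale[OF B] cop.scale_sum_right mult.commute)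
  finally show ?case .
qed

text \<open>Applied below to positivity and to the value of the trace.\<close>

lemma interleave_invariant:
  assumes "\<And>i \<sigma>. i \<in> {1..n} \<Longrightarrow> P \<sigma> \<Longrightarrow> P (A i \<sigma>)"
    and "\<And>i \<sigma>. i \<in> {1..n - 1} \<Longrightarrow> P \<sigma> \<Longrightarrow> P (C i \<sigma>)"
    and "P \<rho>"
  shows "P (interleave A C n \<rho>)"
  using assms
proof (induction n)
  case (Suc n)
  then have "P (interleave A C n \<rho>)"
    by force
  with Suc.prems show ?case
    by (simp add: interleave_Suc)
qed simp

section \<open>Positivity and normalization of the trajectory distribution\<close>

lemma psd_meas_map:
  assumes "psd \<rho>"
  shows "psd (meas_map K m \<rho>)"
proof -
  have adj: "cinner v (A *v w) = cinner (dagger A *v v) w"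
    for v w :: "complex ^ 'a" and A
  proof -
    have "cinner v (A *v w) = (\<Sum>i\<in>UNIV. \<Sum>j\<in>UNIV. cnj (v $ i) * A $ i $ j * w $ j)"
      by (simp add: cinner_def matrix_vector_mult_def sum_distrib_left mult.assoc)
    also have "\<dots> = (\<Sum>j\<in>UNIV. \<Sum>i\<in>UNIV. cnj (v $ i) * A $ i $ j * w $ j)"
      by (rule sum.swap)
    also have "\<dots> = cinner (dagger A *v v) w"
      by (simp add: cinner_def matrix_vector_mult_def dagger_def sum_distrib_left mult_ac)
    finally show ?thesis .
  qed
  \<comment> \<open>Conjugation only changes the vector at which the quadratic form of
    \<open>\<rho>\<close> is evaluated, so nonnegativity carries over.\<close>
  have "cinner v (meas_map K m \<rho> *v v) = cinner (dagger (K m) *v v) (\<rho> *v (dagger (K m) *v v))"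
    for v
    by (simp add: meas_map_def adj matrix_vector_mul_assoc[symmetric])
  then show ?thesis
    using assms by (simp add: psd_def)
qed

text \<open>Positivity is the case of a single block in complete positivity.\<close>

lemma psd_channel:
  assumes "quantum_channel \<Phi>" "psd \<rho>"
  shows "psd (\<Phi> \<rho>)"
proof -
  have "block_psd 1 (\<lambda>_ _. \<rho>)"
    using assms(2) by (simp add: block_psd_def psd_def)
  then have "block_psd 1 (\<lambda>_ _. \<Phi> \<rho>)"
    using assms(1) unfolding quantum_channel_def completely_positive_def by blast
  then have "0 \<le> cinner v (\<Phi> \<rho> *v v)" for v
    unfolding block_psd_def by (auto dest!: spec[of _ "\<lambda>_. v"])
  then show ?thesis
    by (simp add: psd_def)
qed

text \<open>Each diagonal entry is the value of the quadratic form at a standard basis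
  vector.\<close>

lemma trace_psd_nonneg:
  assumes "psd A"
  shows "0 \<le> trace A"
proof -
  have "A $ i $ i = cinner (axis i 1) (A *v axis i 1)" for i
    by (simp add: cinner_def matrix_vector_mult_def axis_def if_distrib[of cnj]
        if_distrib[of "\<lambda>z. z * _"] if_distrib[of "(*) _"] cong: if_cong)
  then show ?thesis
    using assms by (auto simp: trace_def psd_def intro!: sum_nonneg)
qed

lemma traj_prob_nonneg:
  assumes "psd \<rho>" "\<And>i. i \<in> {1..n - 1} \<Longrightarrow> quantum_channel (Ch i)"
  shows "0 \<le> traj_prob K Ch \<rho> n m"
  unfolding traj_prob_def
  by (intro trace_psd_nonneg interleave_invariant[where P = psd])
    (auto intro: psd_meas_map psd_channel assms(1) assms(2)[simplified])

text \<open>Cyclicity of the trace brings \<open>dagger (K m)\<close> next to \<open>K m\<close>,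
  where the completeness relation applies.\<close>

lemma trace_sum_meas_map:
  assumes "(\<Sum>m\<in>M. dagger (K m) ** K m) = mat 1"
  shows "trace (\<Sum>m\<in>M. meas_map K m \<rho>) = trace \<rho>"
proof -
  have "trace (meas_map K m \<rho>) = trace (dagger (K m) ** K m ** \<rho>)" for m
    by (simp add: meas_map_def trace_mul_sym[of _ "dagger (K m)"] matrix_mul_assoc)
  then have "trace (\<Sum>m\<in>M. meas_map K m \<rho>) = trace ((\<Sum>m\<in>M. dagger (K m) ** K m) ** \<rho>)"
    by (simp add: trace_sum matrix_sum_rdistrib)
  then show ?thesis
    by (simp add: assms)
qed

lemma sum_traj_prob:
  assumes K: "(\<Sum>m\<in>M. dagger (K m) ** K m) = mat 1"
    and Ch: "\<And>i. i \<in> {1..n - 1} \<Longrightarrow> quantum_channel (Ch i)"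
  shows "(\<Sum>m\<in>trajectories M n. traj_prob K Ch \<rho> n m) = trace \<rho>"
proof -
  \<comment> \<open>The nonselective measurement, in which the outcome is forgotten. Its alternating
    composition with the channels preserves the trace and expands into all trajectories.\<close>
  let ?A = "\<lambda>_ :: nat. \<lambda>\<sigma>. \<Sum>k\<in>M. meas_map K k \<sigma>"
  have "interleave ?A Ch n \<rho> =
    (\<Sum>m\<in>trajectories M n. (\<Prod>i=1..n. 1) *\<^sub>C interleave (\<lambda>i. meas_map K (m i)) Ch n \<rho>)"
    using Ch by (intro interleave_expansion) (auto simp: quantum_channel_def linear_meas_map)
  moreover have "trace (interleave ?A Ch n \<rho>) = trace \<rho>"
    using Ch by (intro interleave_invariant[where P = "\<lambda>\<sigma>. trace \<sigma> = trace \<rho>"])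
      (auto simp: trace_sum_meas_map[OF K] quantum_channel_def)
  ultimately show ?thesis
    by (simp add: traj_prob_def trace_sum)
qed

lemma finite_trajectories: "finite M \<Longrightarrow> finite (trajectories M n)"
  by (simp add: trajectories_def finite_PiE)

text \<open>This justifies the use of \<open>embed_pmf\<close>: the weights are nonnegative and have
  total mass 1.\<close>

lemma pmf_traj_pmf:
  assumes "finite M" "(\<Sum>m\<in>M. dagger (K m) ** K m) = mat 1" "density_matrix \<rho>"
    and "\<And>i. i \<in> {1..n - 1} \<Longrightarrow> quantum_channel (Ch i)"
  shows "complex_of_real (pmf (traj_pmf M K Ch \<rho> n) m) =
    (if m \<in> trajectories M n then traj_prob K Ch \<rho> n m else 0)"
proof -
  let ?f = "\<lambda>m. if m \<in> trajectories M n then Re (traj_prob K Ch \<rho> n m) else 0"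
  have nonneg: "0 \<le> traj_prob K Ch \<rho> n m" for m
    using assms by (intro traj_prob_nonneg) (auto simp: density_matrix_def)
  \<comment> \<open>In the order on complex numbers, nonnegativity includes a vanishing imaginary
    part, so taking \<open>Re\<close> loses nothing.\<close>
  then have Re_nonneg: "0 \<le> Re (traj_prob K Ch \<rho> n m)"
    and of_real_Re: "complex_of_real (Re (traj_prob K Ch \<rho> n m)) = traj_prob K Ch \<rho> n m" for m
    by (auto simp: less_eq_complex_def complex_eq_iff)
  have "(\<integral>\<^sup>+m. ennreal (?f m) \<partial>count_space UNIV) =
      (\<Sum>m\<in>trajectories M n. ennreal (?f m))"
    using finite_trajectories[OF assms(1)]
    by (intro nn_integral_count_space') auto
  also have "\<dots> = ennreal (\<Sum>m\<in>trajectories M n. Re (traj_prob K Ch \<rho> n m))"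
    using Re_nonneg by (simp add: sum_ennreal)
  also have "(\<Sum>m\<in>trajectories M n. Re (traj_prob K Ch \<rho> n m)) = 1"
    using assms(3) sum_traj_prob[OF assms(2,4), where \<rho> = \<rho>]
    by (simp flip: Re_sum add: density_matrix_def)
  finally have "pmf (traj_pmf M K Ch \<rho> n) m = ?f m"
    unfolding traj_pmf_def by (intro pmf_embed_pmf) (auto simp: Re_nonneg)
  then show ?thesis
    by (simp add: of_real_Re)
qed

section \<open>The quasi-probability formula\<close>

lemma reconstruction_all_operators:
  assumes "\<And>\<rho>. density_matrix \<rho> \<Longrightarrow> proj_map ket x \<rho> = (\<Sum>m\<in>M. c m *\<^sub>C meas_map K m \<rho>)"
  shows "proj_map ket x \<rho> = (\<Sum>m\<in>M. c m *\<^sub>C meas_map K m \<rho>)"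
proof -
  \<comment> \<open>Both sides of the reconstruction identity are linear in \<open>\<rho>\<close>,
    so density matrices decide it.\<close>
  have "Vector_Spaces.linear cscale cscale (\<lambda>\<rho>. \<Sum>m\<in>M. c m *\<^sub>C meas_map K m \<rho>)"
    by (intro cop.linear_compose_sum ballI cop.linear_compose_scale_right linear_meas_map)
  from linear_eq_on_density_matrices[OF linear_proj_map this assms] show ?thesis
    by meson
qed

text \<open>The identity for all operators is what the expansion needs: after multiplication by a
  projection on one side, the intermediate operators are in general no longer density
  matrices.\<close>

lemma quasi_prob_eq_sum_traj_prob:
  assumes "\<And>i \<rho>. i \<in> {1..n} \<Longrightarrow> density_matrix \<rho> \<Longrightarrow>
      proj_map ket (x i) \<rho> = (\<Sum>m\<in>M. \<gamma> (x i) m *\<^sub>C meas_map K m \<rho>)"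
    and "\<And>i. i \<in> {1..n - 1} \<Longrightarrow> quantum_channel (Ch i)"
  shows "quasi_prob ket Ch \<rho> n x =
    (\<Sum>m\<in>trajectories M n. traj_prob K Ch \<rho> n m * (\<Prod>i=1..n. \<gamma> (x i) (m i)))"
proof -
  have "interleave (\<lambda>i. proj_map ket (x i)) Ch n \<rho> =
    (\<Sum>m\<in>trajectories M n. (\<Prod>i=1..n. \<gamma> (x i) (m i)) *\<^sub>C
      interleave (\<lambda>i. meas_map K (m i)) Ch n \<rho>)"
  proof (rule interleave_expansion)
    show "proj_map ket (x i) \<sigma> = (\<Sum>m\<in>M. \<gamma> (x i) m *\<^sub>C meas_map K m \<sigma>)"
      if "i \<in> {1..n}" for i \<sigma>
      by (rule reconstruction_all_operators) (rule assms(1)[OF that])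
  qed (use assms(2) in \<open>auto simp: quantum_channel_def linear_meas_map\<close>)
  then show ?thesis
    by (simp add: quasi_prob_def traj_prob_def trace_sum trace_cscale mult.commute)
qed

theorem mainTheorem2:
  fixes ket :: "nat \<Rightarrow> complex ^ 'd::finite"
    and M :: "'m set" and K :: "'m \<Rightarrow> 'd cop" and \<gamma> :: "nat \<Rightarrow> 'm \<Rightarrow> complex"
    and \<rho>\<^sub>1 :: "'d cop" and Ch :: "nat \<Rightarrow> 'd cop \<Rightarrow> 'd cop" and N :: nat
  assumes "N \<ge> 1"
    and "orthonormal_basis ket"
    and "finite M"
    and "(\<Sum>m\<in>M. dagger (K m) ** K m) = mat 1"
    and "\<And>x \<rho>. x < CARD('d) \<Longrightarrow> density_matrix \<rho> \<Longrightarrow>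
           proj_map ket x \<rho> = (\<Sum>m\<in>M. \<gamma> x m *\<^sub>C meas_map K m \<rho>)"
    and "density_matrix \<rho>\<^sub>1"
    and "\<And>i. i \<in> {1..N - 1} \<Longrightarrow> quantum_channel (Ch i)"
  shows "(\<forall>m. complex_of_real (pmf (traj_pmf M K Ch \<rho>\<^sub>1 N) m) =
              (if m \<in> trajectories M N then traj_prob K Ch \<rho>\<^sub>1 N m else 0)) \<and>
         (\<forall>x. (\<forall>i\<in>{1..N}. x i < CARD('d)) \<longrightarrow>
            quasi_prob ket Ch \<rho>\<^sub>1 N x =
              (\<Sum>m\<in>trajectories M N. traj_prob K Ch \<rho>\<^sub>1 N m * (\<Prod>i=1..N. \<gamma> (x i) (m i))) \<and>
            (\<Sum>m\<in>trajectories M N. traj_prob K Ch \<rho>\<^sub>1 N m * (\<Prod>i=1..N. \<gamma> (x i) (m i))) =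
              measure_pmf.expectation (traj_pmf M K Ch \<rho>\<^sub>1 N) (\<lambda>m. \<Prod>i=1..N. \<gamma> (x i) (m i)))"
proof (intro conjI allI impI)
  show pmf_eq: "complex_of_real (pmf (traj_pmf M K Ch \<rho>\<^sub>1 N) m) =
      (if m \<in> trajectories M N then traj_prob K Ch \<rho>\<^sub>1 N m else 0)" for m
    using assms by (intro pmf_traj_pmf) auto
  fix x :: "nat \<Rightarrow> nat"
  assume x: "\<forall>i\<in>{1..N}. x i < CARD('d)"
  show "quasi_prob ket Ch \<rho>\<^sub>1 N x =
      (\<Sum>m\<in>trajectories M N. traj_prob K Ch \<rho>\<^sub>1 N m * (\<Prod>i=1..N. \<gamma> (x i) (m i)))"
    using assms x by (intro quasi_prob_eq_sum_traj_prob) auto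
  let ?X = "\<lambda>m. \<Prod>i=1..N. \<gamma> (x i) (m i)"
  \<comment> \<open>The mass function vanishes off the finite set of trajectories, which turns the
    expectation into a finite sum.\<close>
  have support: "m \<in> trajectories M N" if "m \<in> set_pmf (traj_pmf M K Ch \<rho>\<^sub>1 N)" for m
    using that pmf_eq[of m] by (auto simp: set_pmf_eq split: if_splits)
  have "measure_pmf.expectation (traj_pmf M K Ch \<rho>\<^sub>1 N) ?X =
      (\<Sum>m\<in>trajectories M N. pmf (traj_pmf M K Ch \<rho>\<^sub>1 N) m *\<^sub>R ?X m)"
    using support by (intro integral_measure_pmf finite_trajectories assms)
  also have "\<dots> = (\<Sum>m\<in>trajectories M N. traj_prob K Ch \<rho>\<^sub>1 N m * ?X m)"
    by (simp add: scaleR_conv_of_real pmf_eq)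
  finally show "(\<Sum>m\<in>trajectories M N. traj_prob K Ch \<rho>\<^sub>1 N m * ?X m) =
      measure_pmf.expectation (traj_pmf M K Ch \<rho>\<^sub>1 N) ?X"
    by simp
qed

end
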